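(* For every $\delta >0$, there exist $\varepsilon > 0$ and $N_0$ such that every $C_{6}^{4-}$-free $4$-graph $\mathcal{H}$ on $n \ge N_0$ vertices with $|\mathcal{H}| \ge \left(\frac12 - \varepsilon\right) \binom{n}{4}$ can be transformed into a complete odd-bipartite $4$-graph (on the same vertex set) by adding and deleting at most $\delta n^4$ edges.
   Context: A $4$-graph ($4$-uniform hypergraph) $\mathcal H$ is a finite vertex set together with a collection of $4$-subsets of it (edges); $|\mathcal H|$ is the number of edges. $\mathcal H$ is $F$-free if it does not contain $F$ as a (not necessarily induced) subgraph. $C_6^4$ is the $4$-graph with six distinct vertices $v_1,\dots,v_6$ and edge set $\{v_iv_{i+1}v_{i+2}v_{i+3} : i\in\mathbb Z/6\mathbb Z\}$ (indices modulo $6$); $C_6^{4-}$ is obtained from $C_6^4$ by removing one edge. A $4$-graph is complete odd-bipartite if its vertex set has a partition $V_1\sqcup V_2$ (a part may be empty) such that its edges are exactly the $4$-sets that meet $V_1$ in an odd number of vertices. *)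

theory Defs
  imports Complex_Main "HOL-Library.Ramsey"
begin

definition four_graph :: "'a set \<Rightarrow> 'a set set \<Rightarrow> bool" where
  "four_graph V E \<longleftrightarrow> finite V \<and> E \<subseteq> nsets V 4"

(* Not necessarily induced: f maps edges of (W, F) to edges of (V, E). *)
definition contains_copy ::
  "'a set \<Rightarrow> 'a set set \<Rightarrow> 'b set \<Rightarrow> 'b set set \<Rightarrow> bool" where
  "contains_copy V E W F \<longleftrightarrow>
     (\<exists>f. inj_on f W \<and> f ` W \<subseteq> V \<and> (\<forall>e\<in>F. f ` e \<in> E))"

definition hfree ::
  "'a set \<Rightarrow> 'a set set \<Rightarrow> 'b set \<Rightarrow> 'b set set \<Rightarrow> bool" where
  "hfree V E W F \<longleftrightarrow> \<not> contains_copy V E W F"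

(* The cycle's vertices v_1, ..., v_6 are represented by the residues 0, ..., 5. *)
definition C64_vertices :: "nat set" where
  "C64_vertices = {..<6}"

definition C64_edge :: "nat \<Rightarrow> nat set" where
  "C64_edge i = {i mod 6, (i + 1) mod 6, (i + 2) mod 6, (i + 3) mod 6}"

definition C64 :: "nat set set" where
  "C64 = C64_edge ` {..<6}"

(* Rotations act transitively on the edges of the cycle, so up to isomorphism it does not
   matter which edge is removed. *)
definition C64_minus :: "nat set set" where
  "C64_minus = C64 - {C64_edge 5}"

definition complete_odd_bipartite :: "'a set \<Rightarrow> 'a set set \<Rightarrow> bool" where
  "complete_odd_bipartite V B \<longleftrightarrow>
     (\<exists>V1 V2. V1 \<union> V2 = V \<and> V1 \<inter> V2 = {} \<and>
        B = {e \<in> nsets V 4. odd (card (e \<inter> V1))})"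

end

theory Submission
  imports Defs "HOL-Analysis.Convex" "HOL-Combinatorics.Multiset_Permutations"
begin

text \<open>
For six vertices, consider the graph formed by the pairs whose complement is an edge of the
\<open>4\<close>-graph \<open>H\<close>.  A copy of the tight six-cycle minus an edge on these vertices is exactly a Hamiltonian
path in this graph.  In an odd-bipartite \<open>4\<close>-graph every perfect matching of the six vertices meets the
graph in zero or two edges; the proof shows that this parity condition holds for almost all
matchings and that it determines the structure.

A graph on six vertices without a Hamiltonian path meets at least four times as many perfect
matchings in exactly one edge as it contains (lemma \<open>matching_sum_nonneg\<close>).  If \<open>t\<close> is the number of
edges of a random matching in the graph, then consequently the probability that \<open>t\<close> is odd is at most
five times the expectation of \<open>t (2 - t)\<close>.  This expectation is \<open>3 \<mu> - 6 \<nu>\<close>, where \<open>\<mu>\<close> is the edge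
density of \<open>H\<close> and \<open>\<nu>\<close> the density of pairs of edges that share a given pair of vertices.  Since
\<open>\<nu> \<ge> \<mu>\<^sup>2\<close> by Cauchy--Schwarz, it is at most \<open>3 \<mu> (1 - 2 \<mu>)\<close> up to lower-order terms.  Hence \<open>\<mu>\<close> cannot
much exceed one half, and if it is close to one half then almost all matchings are even
(lemma \<open>card_odd_tuples_le\<close>).

Evenness of the matching \<open>ab, cd, ef\<close> is the linear relation
\<open>H(abcd) + H(abef) + H(cdef) = 0\<close> modulo two.  Five such relations combine to
\<open>H(abcd) = H(rsya) + H(rsyb) + H(rsyc) + H(rsyd)\<close> (lemma \<open>even_matchings_imp_parity\<close>).  For a suitable
triple \<open>r, s, y\<close> this holds for almost all \<open>a, b, c, d\<close>, and it says that \<open>H\<close> nearly agrees with the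
odd-bipartite \<open>4\<close>-graph whose first part consists of the vertices that form an edge with \<open>r, s, y\<close>
(lemma \<open>exists_odd_bipartite_close\<close>).
\<close>

section \<open>Perfect matchings and graphs without a Hamiltonian path\<close>

text \<open>The terms run over the fifteen perfect matchings of a six-element vertex set: the partner of the
first vertex is chosen by one transposition, the partner of the third by another.  Only
transpositions of the six arguments occur, so that symmetry under these is all that is needed to
compare or average such sums.\<close>

definition matching_sum ::
  "('a \<Rightarrow> 'a \<Rightarrow> 'a \<Rightarrow> 'a \<Rightarrow> 'a \<Rightarrow> 'a \<Rightarrow> int) \<Rightarrow> 'a \<Rightarrow> 'a \<Rightarrow> 'a \<Rightarrow> 'a \<Rightarrow> 'a \<Rightarrow> 'a \<Rightarrow> int"
  where
  "matching_sum F a b c d e f =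
     (let R = (\<lambda>a b c d e f. F a b c d e f + F a b c e d f + F a b c f e d)
      in R a b c d e f + R a c b d e f + R a d c b e f + R a e c d b f + R a f c d e b)"

definition edge_count :: "('a \<Rightarrow> 'a \<Rightarrow> bool) \<Rightarrow> 'a \<Rightarrow> 'a \<Rightarrow> 'a \<Rightarrow> 'a \<Rightarrow> 'a \<Rightarrow> 'a \<Rightarrow> int"
  where
  "edge_count g a b c d e f = of_bool (g a b) + of_bool (g c d) + of_bool (g e f)"

text \<open>The weights \<open>1\<close> and \<open>-4\<close> are chosen so that the total score over the fifteen matchings of a graph
without a Hamiltonian path is nonnegative.  The constant four is optimal: the disjoint union of
\<open>K\<^sub>4\<close> and \<open>K\<^sub>2\<close> has three perfect matchings contained in it and twelve that it meets in exactly one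
edge.  Any constant larger than three would serve the stability argument.\<close>

definition matching_score :: "('a \<Rightarrow> 'a \<Rightarrow> bool) \<Rightarrow> 'a \<Rightarrow> 'a \<Rightarrow> 'a \<Rightarrow> 'a \<Rightarrow> 'a \<Rightarrow> 'a \<Rightarrow> int"
  where
  "matching_score g a b c d e f =
     of_bool (edge_count g a b c d e f = 1) - 4 * of_bool (edge_count g a b c d e f = 3)"

lemma matching_score_cases:
  "matching_score g a b c d e f =
     (if g a b then if g c d then if g e f then -4 else 0 else if g e f then 0 else 1
      else if g c d then if g e f then 0 else 1 else if g e f then 1 else 0)"
  by (simp add: matching_score_def edge_count_def)

text \<open>If a graph contains the matching \<open>ab, cd, ef\<close> and has no Hamiltonian path, then an edge of the
matching cannot be left through one end towards the second matching edge and through the other end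
towards the third: these edges would concatenate to a path through all six vertices.  The six
resulting constraints leave few graphs (at most one pair of matching edges is joined, or two pairs
are joined through a common vertex, or the graph is a triangle with three pendant edges), and for
each of them the inequality is a count over the fifteen matchings.\<close>

lemma matching_sum_nonneg_matched:
  fixes g :: "'a \<Rightarrow> 'a \<Rightarrow> bool"
  assumes sym: "\<And>x y. g x y = g y x"
    and nopath: "\<And>u v w x y z. {u,v,w,x,y,z} = {a,b,c,d,e,f} \<Longrightarrow>
                   \<not> (g u v \<and> g v w \<and> g w x \<and> g x y \<and> g y z)"
    and matched: "g a b" "g c d" "g e f"
  shows "matching_sum (matching_score g) a b c d e f \<ge> 0"
proof -
  have clause: "\<not> (g p q \<and> g r s)"
    if "{u,p,q,r,s,t} = {a,b,c,d,e,f}" "g u p" "g q r" "g s t" for u p q r s t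
    using nopath[OF that(1)] that(2-) by blast
  have m: "g b a" "g d c" "g f e" using matched sym by blast+
  \<comment> \<open>The name of each constraint gives the middle edge of the forbidden path, in the direction in
    which it is traversed from the matching edge listed first among the other two.\<close>
  have middle_cd: "\<not> ((g a c \<or> g b c) \<and> (g d e \<or> g d f))"
    using clause[of a b c d e f] clause[of a b c d f e] clause[of b a c d e f] clause[of b a c d f e]
      matched m by (auto simp: insert_commute)
  have middle_dc: "\<not> ((g a d \<or> g b d) \<and> (g c e \<or> g c f))"
    using clause[of a b d c e f] clause[of a b d c f e] clause[of b a d c e f] clause[of b a d c f e]
      matched m by (auto simp: insert_commute)
  have middle_ab: "\<not> ((g a c \<or> g a d) \<and> (g b e \<or> g b f))"
    using clause[of c d a b e f] clause[of c d a b f e] clause[of d c a b e f] clause[of d c a b f e]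
      matched m sym[of c a] sym[of d a] by (auto simp: insert_commute)
  have middle_ba: "\<not> ((g b c \<or> g b d) \<and> (g a e \<or> g a f))"
    using clause[of c d b a e f] clause[of c d b a f e] clause[of d c b a e f] clause[of d c b a f e]
      matched m sym[of c b] sym[of d b] by (auto simp: insert_commute)
  have middle_ef: "\<not> ((g a e \<or> g b e) \<and> (g c f \<or> g d f))"
    using clause[of a b e f c d] clause[of a b e f d c] clause[of b a e f c d] clause[of b a e f d c]
      matched m sym[of f c] sym[of f d] by (auto simp: insert_commute)
  have middle_fe: "\<not> ((g a f \<or> g b f) \<and> (g c e \<or> g d e))"
    using clause[of a b f e c d] clause[of a b f e d c] clause[of b a f e c d] clause[of b a f e d c]
      matched m sym[of e c] sym[of e d] by (auto simp: insert_commute)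
  have s: "g c b = g b c" "g d b = g b d" "g e b = g b e" "g f b = g b f"
    "g e d = g d e" "g f d = g d f" "g d c = g c d" "g f e = g e f" "g e c = g c e" "g f c = g c f"
    using sym by blast+
  show ?thesis
    using middle_cd middle_dc middle_ab middle_ba middle_ef middle_fe
    unfolding matching_sum_def Let_def matching_score_cases s
    by (simp only: matched m s if_True;
        cases "g a c"; cases "g a d"; cases "g b c"; cases "g b d"; simp only: if_True if_False simp_thms;
        cases "g a e"; cases "g a f"; simp only: if_True if_False simp_thms;
        cases "g b e"; cases "g b f"; simp only: if_True if_False simp_thms;
        cases "g c e"; cases "g c f"; simp only: if_True if_False simp_thms;
        cases "g d e"; cases "g d f"; simp)
qed

text \<open>A negative score arises only from a perfect matching contained in the graph.  The sum over all
matchings does not change when the vertices are renamed, so such a matching can be assumed to be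
\<open>ab, cd, ef\<close>.\<close>

lemma matching_sum_nonneg:
  fixes g :: "'a \<Rightarrow> 'a \<Rightarrow> bool"
  assumes sym: "\<And>x y. g x y = g y x"
    and nopath: "\<And>u v w x y z. {u,v,w,x,y,z} = {a,b,c,d,e,f} \<Longrightarrow>
                   \<not> (g u v \<and> g v w \<and> g w x \<and> g x y \<and> g y z)"
  shows "matching_sum (matching_score g) a b c d e f \<ge> 0"
proof -
  let ?S = "{a,b,c,d,e,f}"
  let ?T = "matching_sum (matching_score g)"
  let ?full = "\<lambda>a b c d e f. g a b \<and> g c d \<and> g e f"
  have swap_de: "?T p q r s t u = ?T p q r t s u"
   and swap_df: "?T p q r s t u = ?T p q r u t s"
   and swap_bc: "?T p q r s t u = ?T p r q s t u"
   and swap_bd: "?T p q r s t u = ?T p s r q t u"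
   and swap_be: "?T p q r s t u = ?T p t r s q u"
   and swap_bf: "?T p q r s t u = ?T p u r s t q" for p q r s t u
    by (simp_all add: matching_sum_def Let_def matching_score_def edge_count_def ac_simps sym)
  have full1: "?T p q r s t u \<ge> 0" if "{p,q,r,s,t,u} = ?S" "?full p q r s t u" for p q r s t u
    using matching_sum_nonneg_matched[of g p q r s t u] sym nopath that by metis
  have full3: "?T p q r s t u \<ge> 0" if S: "{p,q,r,s,t,u} = ?S"
    and "?full p q r s t u \<or> ?full p q r t s u \<or> ?full p q r u t s" for p q r s t u
  proof -
    have "{p,q,r,t,s,u} = ?S" "{p,q,r,u,t,s} = ?S" using S by (auto simp: insert_commute)
    then show ?thesis using that full1 swap_de swap_df by metis
  qed
  have S: "{a,c,b,d,e,f} = ?S" "{a,d,c,b,e,f} = ?S" "{a,e,c,d,b,f} = ?S" "{a,f,c,d,e,b} = ?S"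
    by auto
  let ?some = "\<lambda>p q r s t u. ?full p q r s t u \<or> ?full p q r t s u \<or> ?full p q r u t s"
  consider "?some a b c d e f" | "?some a c b d e f" | "?some a d c b e f" | "?some a e c d b f"
    | "?some a f c d e b"
    | "\<not> ?some a b c d e f" "\<not> ?some a c b d e f" "\<not> ?some a d c b e f"
      "\<not> ?some a e c d b f" "\<not> ?some a f c d e b"
    by argo
  then show ?thesis
  proof cases
    case 1
    then show ?thesis by (rule full3[OF refl])
  next
    case 2
    then show ?thesis unfolding swap_bc[of a b c d e f] by (rule full3[OF S(1)])
  next
    case 3
    then show ?thesis unfolding swap_bd[of a b c d e f] by (rule full3[OF S(2)])
  next
    case 4
    then show ?thesis unfolding swap_be[of a b c d e f] by (rule full3[OF S(3)])
  next
    case 5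
    then show ?thesis unfolding swap_bf[of a b c d e f] by (rule full3[OF S(4)])
  next
    case 6
    have pos: "0 \<le> matching_score g p q r s t u" if "\<not> ?full p q r s t u" for p q r s t u
      using that by (auto simp: matching_score_cases)
    have "0 \<le> matching_score g p q r s t u + matching_score g p q r t s u + matching_score g p q r u t s"
      if "\<not> ?some p q r s t u" for p q r s t u
      using that by (intro add_nonneg_nonneg pos) blast+
    from this[OF 6(1)] this[OF 6(2)] this[OF 6(3)] this[OF 6(4)] this[OF 6(5)]
    show ?thesis
      unfolding matching_sum_def Let_def by linarith
  qed
qed

section \<open>Averaging over ordered six-tuples\<close>

text \<open>Ordered tuples are used instead of six-element sets because sums over them can be reindexed by
permuting coordinates.  Degenerate tuples, with repeated vertices, are kept in \<open>tuples6\<close>, where sums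
factor; they number only \<open>O(n\<^sup>5)\<close>.\<close>

definition distinct6 :: "'a set \<Rightarrow> ('a \<times> 'a \<times> 'a \<times> 'a \<times> 'a \<times> 'a) set" where
  "distinct6 V = {(a,b,c,d,e,f). {a,b,c,d,e,f} \<subseteq> V \<and> distinct [a,b,c,d,e,f]}"

definition tuples6 :: "'a set \<Rightarrow> ('a \<times> 'a \<times> 'a \<times> 'a \<times> 'a \<times> 'a) set" where
  "tuples6 V = V \<times> V \<times> V \<times> V \<times> V \<times> V"

text \<open>In terms of the graph on \<open>{a,b,c,d,e,f}\<close> whose edges are the pairs with complement in \<open>H\<close>, this says
that the matching \<open>ab, cd, ef\<close> meets the graph in an even number of edges.\<close>

definition even_matching :: "'a set set \<Rightarrow> 'a \<Rightarrow> 'a \<Rightarrow> 'a \<Rightarrow> 'a \<Rightarrow> 'a \<Rightarrow> 'a \<Rightarrow> bool" where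
  "even_matching H a b c d e f \<longleftrightarrow>
     ({a,b,c,d} \<in> H \<longleftrightarrow> ({a,b,e,f} \<in> H) \<noteq> ({c,d,e,f} \<in> H))"

text \<open>Each of the fifteen summands is \<open>F\<close> composed with a permutation of the coordinates, and such a
permutation preserves the set of injective tuples.\<close>

lemma sum_matching_sum:
  "(\<Sum>(a,b,c,d,e,f)\<in>distinct6 V. matching_sum F a b c d e f)
     = 15 * (\<Sum>(a,b,c,d,e,f)\<in>distinct6 V. F a b c d e f)"
proof -
  let ?I = "distinct6 V"
  have de: "(\<Sum>(a,b,c,d,e,f)\<in>?I. G a b c e d f) = (\<Sum>(a,b,c,d,e,f)\<in>?I. G a b c d e f)"
   and df: "(\<Sum>(a,b,c,d,e,f)\<in>?I. G a b c f e d) = (\<Sum>(a,b,c,d,e,f)\<in>?I. G a b c d e f)"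
   and bc: "(\<Sum>(a,b,c,d,e,f)\<in>?I. G a c b d e f) = (\<Sum>(a,b,c,d,e,f)\<in>?I. G a b c d e f)"
   and bd: "(\<Sum>(a,b,c,d,e,f)\<in>?I. G a d c b e f) = (\<Sum>(a,b,c,d,e,f)\<in>?I. G a b c d e f)"
   and be: "(\<Sum>(a,b,c,d,e,f)\<in>?I. G a e c d b f) = (\<Sum>(a,b,c,d,e,f)\<in>?I. G a b c d e f)"
   and bf: "(\<Sum>(a,b,c,d,e,f)\<in>?I. G a f c d e b) = (\<Sum>(a,b,c,d,e,f)\<in>?I. G a b c d e f)"
    for G :: "'a \<Rightarrow> 'a \<Rightarrow> 'a \<Rightarrow> 'a \<Rightarrow> 'a \<Rightarrow> 'a \<Rightarrow> int"
    subgoal by (rule sum.reindex_bij_witness[where i="\<lambda>(a,b,c,d,e,f). (a,b,c,e,d,f)" and j="\<lambda>(a,b,c,d,e,f). (a,b,c,e,d,f)"])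
        (auto simp: distinct6_def)
    subgoal by (rule sum.reindex_bij_witness[where i="\<lambda>(a,b,c,d,e,f). (a,b,c,f,e,d)" and j="\<lambda>(a,b,c,d,e,f). (a,b,c,f,e,d)"])
        (auto simp: distinct6_def)
    subgoal by (rule sum.reindex_bij_witness[where i="\<lambda>(a,b,c,d,e,f). (a,c,b,d,e,f)" and j="\<lambda>(a,b,c,d,e,f). (a,c,b,d,e,f)"])
        (auto simp: distinct6_def)
    subgoal by (rule sum.reindex_bij_witness[where i="\<lambda>(a,b,c,d,e,f). (a,d,c,b,e,f)" and j="\<lambda>(a,b,c,d,e,f). (a,d,c,b,e,f)"])
        (auto simp: distinct6_def)
    subgoal by (rule sum.reindex_bij_witness[where i="\<lambda>(a,b,c,d,e,f). (a,e,c,d,b,f)" and j="\<lambda>(a,b,c,d,e,f). (a,e,c,d,b,f)"])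
        (auto simp: distinct6_def)
    subgoal by (rule sum.reindex_bij_witness[where i="\<lambda>(a,b,c,d,e,f). (a,f,c,d,e,b)" and j="\<lambda>(a,b,c,d,e,f). (a,f,c,d,e,b)"])
        (auto simp: distinct6_def)
    done
  let ?R = "\<lambda>a b c d e f. F a b c d e f + F a b c e d f + F a b c f e d"
  have R: "(\<Sum>(a,b,c,d,e,f)\<in>?I. ?R a b c d e f) = 3 * (\<Sum>(a,b,c,d,e,f)\<in>?I. F a b c d e f)"
    using de[of F] df[of F] by (simp add: case_prod_unfold sum.distrib)
  have "(\<Sum>(a,b,c,d,e,f)\<in>?I. matching_sum F a b c d e f) =
      (\<Sum>(a,b,c,d,e,f)\<in>?I. ?R a b c d e f) + (\<Sum>(a,b,c,d,e,f)\<in>?I. ?R a c b d e f)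
    + (\<Sum>(a,b,c,d,e,f)\<in>?I. ?R a d c b e f) + (\<Sum>(a,b,c,d,e,f)\<in>?I. ?R a e c d b f)
    + (\<Sum>(a,b,c,d,e,f)\<in>?I. ?R a f c d e b)"
    by (simp add: matching_sum_def Let_def case_prod_unfold sum.distrib)
  also have "\<dots> = 5 * (\<Sum>(a,b,c,d,e,f)\<in>?I. ?R a b c d e f)"
    unfolding bc[of ?R] bd[of ?R] be[of ?R] bf[of ?R] by simp
  finally show ?thesis using R by simp
qed

text \<open>The two-element complements of the edges \<open>0123, 1234, 2345, 3450, 4501\<close> of the tight cycle minus an
edge are \<open>45, 50, 01, 12, 23\<close>, which form the Hamiltonian path \<open>4, 5, 0, 1, 2, 3\<close>.\<close>

lemma no_hamiltonian_path:
  assumes free: "hfree V H C64_vertices C64_minus"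
    and S: "{u,v,w,x,y,z} \<subseteq> V" "distinct [u,v,w,x,y,z]"
  defines "g \<equiv> \<lambda>p q. {u,v,w,x,y,z} - {p,q} \<in> H"
  shows "\<not> (g u v \<and> g v w \<and> g w x \<and> g x y \<and> g y z)"
proof
  assume path: "g u v \<and> g v w \<and> g w x \<and> g x y \<and> g y z"
  \<comment> \<open>The path visits the residues in the order \<open>4, 5, 0, 1, 2, 3\<close>, so its third vertex is the image
    of \<open>0\<close>.\<close>
  define \<phi> where "\<phi> = (\<lambda>i::nat. [w,x,y,z,u,v] ! i)"
  have lt6: "{..<6::nat} = {0,1,2,3,4,5}" by auto
  have vals: "\<phi> 0 = w" "\<phi> 1 = x" "\<phi> (Suc 0) = x" "\<phi> 2 = y" "\<phi> 3 = z" "\<phi> 4 = u" "\<phi> 5 = v"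
    by (simp_all add: \<phi>_def)
  have edges: "C64_edge 0 = {0,1,2,3}" "C64_edge 1 = {1,2,3,4}" "C64_edge 2 = {2,3,4,5}"
    "C64_edge 3 = {3,4,5,0}" "C64_edge 4 = {4,5,0,1}"
    by (auto simp: C64_edge_def)
  have sets: "{u,v,w,x,y,z} - {u,v} = {w,x,y,z}" "{u,v,w,x,y,z} - {v,w} = {x,y,z,u}"
    "{u,v,w,x,y,z} - {w,x} = {y,z,u,v}" "{u,v,w,x,y,z} - {x,y} = {z,u,v,w}"
    "{u,v,w,x,y,z} - {y,z} = {u,v,w,x}"
    using S(2) by auto
  have "C64_minus \<subseteq> C64_edge ` {0,1,2,3,4}"
    unfolding C64_minus_def C64_def lt6 by blast
  moreover have "\<phi> ` C64_edge i \<in> H" if "i \<in> {0,1,2,3,4}" for i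
    using that path unfolding g_def sets
    by (elim insertE) (simp_all only: edges image_insert image_empty vals, auto)
  ultimately have "\<forall>e\<in>C64_minus. \<phi> ` e \<in> H" by blast
  moreover have "inj_on \<phi> C64_vertices"
    unfolding C64_vertices_def lt6 using S(2) by (auto simp: inj_on_def vals)
  moreover have "\<phi> ` C64_vertices \<subseteq> V"
    unfolding C64_vertices_def lt6 using S(1) by (auto simp: vals)
  ultimately have "contains_copy V H C64_vertices C64_minus"
    unfolding contains_copy_def by blast
  then show False using free by (simp add: hfree_def)
qed

lemma sum_matching_score_nonneg:
  assumes free: "hfree V H C64_vertices C64_minus"
  shows "0 \<le> (\<Sum>(a,b,c,d,e,f)\<in>distinct6 V.
              matching_score (\<lambda>x y. {a,b,c,d,e,f} - {x,y} \<in> H) a b c d e f)"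
proof -
  let ?F = "\<lambda>a b c d e f. matching_score (\<lambda>x y. {a,b,c,d,e,f} - {x,y} \<in> H) a b c d e f"
  have "0 \<le> matching_sum ?F a b c d e f" if "(a,b,c,d,e,f) \<in> distinct6 V" for a b c d e f
  proof -
    let ?S = "{a,b,c,d,e,f}"
    let ?g = "\<lambda>x y. ?S - {x,y} \<in> H"
    have perms: "{a,b,c,e,d,f} = ?S" "{a,b,c,f,e,d} = ?S"
      "{a,c,b,d,e,f} = ?S" "{a,c,b,e,d,f} = ?S" "{a,c,b,f,e,d} = ?S"
      "{a,d,c,b,e,f} = ?S" "{a,d,c,e,b,f} = ?S" "{a,d,c,f,e,b} = ?S"
      "{a,e,c,d,b,f} = ?S" "{a,e,c,b,d,f} = ?S" "{a,e,c,f,b,d} = ?S"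
      "{a,f,c,d,e,b} = ?S" "{a,f,c,e,d,b} = ?S" "{a,f,c,b,e,d} = ?S"
      by auto
    have "matching_sum ?F a b c d e f = matching_sum (matching_score ?g) a b c d e f"
      by (simp only: matching_sum_def Let_def perms)
    moreover have "0 \<le> matching_sum (matching_score ?g) a b c d e f"
    proof (rule matching_sum_nonneg)
      show "?g x y = ?g y x" for x y by (simp add: insert_commute)
      fix u v w x y z assume eq: "{u,v,w,x,y,z} = ?S"
      have "card ?S = 6" using that by (simp add: distinct6_def)
      then have "card (set [u,v,w,x,y,z]) = length [u,v,w,x,y,z]" by (simp add: eq)
      then have "distinct [u,v,w,x,y,z]" by (rule card_distinct)
      moreover have "{u,v,w,x,y,z} \<subseteq> V" using that unfolding eq by (simp add: distinct6_def)
      ultimately show "\<not> (?g u v \<and> ?g v w \<and> ?g w x \<and> ?g x y \<and> ?g y z)"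
        using no_hamiltonian_path[OF free, of u v w x y z] unfolding eq by blast
    qed
    ultimately show ?thesis by simp
  qed
  then have "0 \<le> (\<Sum>(a,b,c,d,e,f)\<in>distinct6 V. matching_sum ?F a b c d e f)"
    by (intro sum_nonneg) auto
  then show ?thesis unfolding sum_matching_sum by simp
qed

text \<open>With \<open>t\<close> the number of edges of the matching \<open>ab, cd, ef\<close> in the complement graph, the quantity
\<open>t (2 - t)\<close> equals \<open>1, 0, -3\<close> for \<open>t = 1, 2, 3\<close>, and therefore the indicator of odd \<open>t\<close> is
\<open>5 t (2 - t)\<close> minus four times the score of the matching.  The score is nonnegative on average, and
the average of \<open>t (2 - t)\<close> reduces by symmetry to the densities of an edge and of two edges
sharing a pair.\<close>

lemma card_odd_matchings_le:
  assumes fin: "finite V" and free: "hfree V H C64_vertices C64_minus"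
  defines "h \<equiv> \<lambda>a b c d. of_bool ({a,b,c,d} \<in> H) :: int"
  shows "int (card {(a,b,c,d,e,f)\<in>distinct6 V. \<not> even_matching H a b c d e f})
     \<le> 15 * (\<Sum>(a,b,c,d,e,f)\<in>distinct6 V. h a b c d - 2 * (h a b c d * h a b e f))"
proof -
  let ?I = "distinct6 V"
  let ?S = "\<lambda>G. (\<Sum>(a,b,c,d,e,f)\<in>?I. G a b c d e f)"
  let ?F = "\<lambda>a b c d e f. matching_score (\<lambda>x y. {a,b,c,d,e,f} - {x,y} \<in> H) a b c d e f"
  let ?N = "\<lambda>a b c d e f. of_bool (\<not> even_matching H a b c d e f) :: int"
  let ?Q = "\<lambda>a b c d e f. h a b c d + h a b e f + h c d e f
     - 2 * (h a b c d * h a b e f + h a b e f * h c d e f + h a b c d * h c d e f)"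
  have finI: "finite ?I"
    by (rule finite_subset[of _ "V \<times> V \<times> V \<times> V \<times> V \<times> V"]) (auto simp: distinct6_def fin)
  \<comment> \<open>\<open>?Q\<close> is \<open>t (2 - t)\<close>, using \<open>t\<^sup>2 = t + 2 (xy + yz + xz)\<close> for a sum \<open>t = x + y + z\<close> of indicators.\<close>
  have point: "?N a b c d e f \<le> 5 * ?Q a b c d e f - 4 * ?F a b c d e f"
    if "(a,b,c,d,e,f) \<in> ?I" for a b c d e f
  proof -
    have "{a,b,c,d,e,f} - {a,b} = {c,d,e,f}" "{a,b,c,d,e,f} - {c,d} = {a,b,e,f}"
      "{a,b,c,d,e,f} - {e,f} = {a,b,c,d}"
      using that by (auto simp: distinct6_def)
    then show ?thesis
      by (simp add: matching_score_cases h_def even_matching_def)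
  qed
  have ce_df: "?S (\<lambda>a b c d e f. G a b e f c d) = ?S G"
   and ae_bf: "?S (\<lambda>a b c d e f. G e f c d a b) = ?S G"
   and ac_bd: "?S (\<lambda>a b c d e f. G c d a b e f) = ?S G"
    for G :: "'a \<Rightarrow> 'a \<Rightarrow> 'a \<Rightarrow> 'a \<Rightarrow> 'a \<Rightarrow> 'a \<Rightarrow> int"
    subgoal by (rule sum.reindex_bij_witness[where i="\<lambda>(a,b,c,d,e,f). (a,b,e,f,c,d)" and j="\<lambda>(a,b,c,d,e,f). (a,b,e,f,c,d)"])
        (auto simp: distinct6_def)
    subgoal by (rule sum.reindex_bij_witness[where i="\<lambda>(a,b,c,d,e,f). (e,f,c,d,a,b)" and j="\<lambda>(a,b,c,d,e,f). (e,f,c,d,a,b)"])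
        (auto simp: distinct6_def)
    subgoal by (rule sum.reindex_bij_witness[where i="\<lambda>(a,b,c,d,e,f). (c,d,a,b,e,f)" and j="\<lambda>(a,b,c,d,e,f). (c,d,a,b,e,f)"])
        (auto simp: distinct6_def)
    done
  let ?X = "\<lambda>a b c d e f. h a b c d"
  let ?XY = "\<lambda>a b c d e f. h a b c d * h a b e f"
  have odd_eq: "{(a,b,c,d,e,f)\<in>?I. \<not> even_matching H a b c d e f}
     = ?I \<inter> {(a,b,c,d,e,f). \<not> even_matching H a b c d e f}"
    by auto
  have "int (card {(a,b,c,d,e,f)\<in>?I. \<not> even_matching H a b c d e f}) = ?S ?N"
    unfolding odd_eq by (simp add: case_prod_unfold finI)
  also have "\<dots> \<le> ?S (\<lambda>a b c d e f. 5 * ?Q a b c d e f - 4 * ?F a b c d e f)"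
    using point by (intro sum_mono) auto
  also have "\<dots> = 5 * ?S ?Q - 4 * ?S ?F"
    by (simp add: case_prod_unfold sum_subtractf sum_distrib_left)
  also have "\<dots> \<le> 5 * ?S ?Q"
    using sum_matching_score_nonneg[OF free] by simp
  also have "?S ?Q = ?S ?X + ?S (\<lambda>a b c d e f. h a b e f) + ?S (\<lambda>a b c d e f. h c d e f)
     - 2 * (?S ?XY + ?S (\<lambda>a b c d e f. h a b e f * h c d e f) + ?S (\<lambda>a b c d e f. h a b c d * h c d e f))"
    by (simp add: case_prod_unfold sum_subtractf sum.distrib sum_distrib_left)
  also have "?S (\<lambda>a b c d e f. h a b e f) = ?S ?X" using ce_df[of ?X] .
  also have "?S (\<lambda>a b c d e f. h c d e f) = ?S ?X"
    using ae_bf[of ?X] unfolding h_def by (simp add: insert_commute)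
  also have "?S (\<lambda>a b c d e f. h a b e f * h c d e f) = ?S ?XY"
    using ae_bf[of ?XY] unfolding h_def by (simp add: insert_commute mult.commute)
  also have "?S (\<lambda>a b c d e f. h a b c d * h c d e f) = ?S ?XY"
    using ac_bd[of ?XY] unfolding h_def by (simp add: insert_commute mult.commute)
  also have "5 * (?S ?X + ?S ?X + ?S ?X - 2 * (?S ?XY + ?S ?XY + ?S ?XY)) =
     15 * ?S (\<lambda>a b c d e f. h a b c d - 2 * (h a b c d * h a b e f))"
    by (simp add: case_prod_unfold sum_subtractf flip: sum_distrib_left)
  finally show ?thesis .
qed

section \<open>Counting tuples and Cauchy--Schwarz\<close>

text \<open>With \<open>u = n (n - 5)\<close> the falling factorial is \<open>u (u + 4) (u + 6)\<close>, hence at least \<open>u\<^sup>3\<close>.\<close>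

lemma card_distinct6_ge:
  assumes "finite V"
  shows "real (card V) ^ 6 - 15 * real (card V) ^ 5 \<le> real (card (distinct6 V))"
proof -
  let ?n = "card V" and ?x = "real (card V)"
  let ?L = "{xs. length xs = 6 \<and> distinct xs \<and> set xs \<subseteq> V}"
  have "bij_betw (\<lambda>(a,b,c,d,e,f). [a,b,c,d,e,f]) (distinct6 V) ?L"
    by (rule bij_betw_byWitness[where f' = "\<lambda>xs. (xs!0, xs!1, xs!2, xs!3, xs!4, xs!5)"])
       (auto simp: distinct6_def numeral_eq_Suc length_Suc_conv)
  then have card: "card (distinct6 V) = card ?L" by (rule bij_betw_same_card)
  show ?thesis
  proof (cases "?n < 6")
    case True
    then have "?x ^ 5 * (?x - 15) \<le> 0" by (intro mult_nonneg_nonpos) auto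
    then have "?x ^ 6 - 15 * ?x ^ 5 \<le> 0" by (simp add: algebra_simps eval_nat_numeral)
    then show ?thesis using of_nat_0_le_iff[of "card (distinct6 V)"] by linarith
  next
    case False
    then obtain m where m: "?n = m + 6" by (metis add.commute le_Suc_ex not_less)
    have "{?n - 6 + 1..?n} = {m+1, m+2, m+3, m+4, m+5, m+6}" unfolding m by auto
    then have card_L: "card ?L = \<Prod>{m+1, m+2, m+3, m+4, m+5, m+6}"
      using card_lists_distinct_length_eq[OF assms, of 6] m by simp
    have "real (card (distinct6 V)) = (?x-5) * (?x-4) * (?x-3) * (?x-2) * (?x-1) * ?x"
      unfolding card card_L by (simp add: m algebra_simps)
    moreover have "?x ^ 6 - 15 * ?x ^ 5 \<le> (?x-5) * (?x-4) * (?x-3) * (?x-2) * (?x-1) * ?x"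
    proof -
      define u where "u = ?x * (?x - 5)"
      have u: "u \<ge> 0" using False by (simp add: u_def)
      have "?x ^ 6 - 15 * ?x ^ 5 \<le> ?x ^ 3 * (?x ^ 3 - 15 * ?x ^ 2 + 75 * ?x - 125)"
        using False by (simp add: algebra_simps eval_nat_numeral)
      also have "\<dots> = u ^ 3" by (simp add: u_def algebra_simps eval_nat_numeral)
      also have "\<dots> \<le> u * (u + 4) * (u + 6)"
        using u by (simp add: algebra_simps eval_nat_numeral)
      also have "\<dots> = (?x-5) * (?x-4) * (?x-3) * (?x-2) * (?x-1) * ?x"
        by (simp add: u_def algebra_simps)
      finally show ?thesis .
    qed
    ultimately show ?thesis by simp
  qed
qed

lemma card_edge_tuples:
  assumes "four_graph V H"
  shows "card {(a,b,c,d)\<in>V \<times> V \<times> V \<times> V. {a,b,c,d} \<in> H} = 24 * card H"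
proof -
  let ?T = "{(a,b,c,d)\<in>V \<times> V \<times> V \<times> V. {a,b,c,d} \<in> H}"
  have fin: "finite V" and H: "\<And>e. e \<in> H \<Longrightarrow> e \<subseteq> V \<and> finite e \<and> card e = 4"
    using assms by (auto simp: four_graph_def nsets_def)
  have finH: "finite H" using fin H by (meson PowI finite_Pow_iff finite_subset subsetI)
  have "bij_betw (\<lambda>(a,b,c,d). [a,b,c,d]) ?T (\<Union>e\<in>H. permutations_of_set e)"
  proof (rule bij_betw_byWitness[where f' = "\<lambda>xs. (xs!0, xs!1, xs!2, xs!3)"])
    show "(\<lambda>(a,b,c,d). [a,b,c,d]) ` ?T \<subseteq> (\<Union>e\<in>H. permutations_of_set e)"
    proof clarify
      fix a b c d assume "{a,b,c,d} \<in> H"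
      moreover from this have "distinct [a,b,c,d]"
        using H by (intro card_distinct) (simp add: insert_commute)
      ultimately show "[a,b,c,d] \<in> (\<Union>e\<in>H. permutations_of_set e)"
        by (intro UN_I[of "{a,b,c,d}"] permutations_of_setI) auto
    qed
    have list4: "\<exists>a b c d. xs = [a,b,c,d]" if "e \<in> H" "xs \<in> permutations_of_set e" for e xs
    proof -
      have "length xs = 4" using that H length_finite_permutations_of_set by metis
      then show ?thesis by (auto simp: numeral_eq_Suc length_Suc_conv)
    qed
    then show "\<forall>xs\<in>\<Union>e\<in>H. permutations_of_set e.
        (case (xs!0, xs!1, xs!2, xs!3) of (a,b,c,d) \<Rightarrow> [a,b,c,d]) = xs"
      by (fastforce simp: numeral_3_eq_3)
    show "(\<lambda>xs. (xs!0, xs!1, xs!2, xs!3)) ` (\<Union>e\<in>H. permutations_of_set e) \<subseteq> ?T"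
    proof (rule image_subsetI, elim UN_E)
      fix e xs assume e: "e \<in> H" and xs: "xs \<in> permutations_of_set e"
      then obtain a b c d where [simp]: "xs = [a,b,c,d]" using list4 by blast
      have "{a,b,c,d} = e" using permutations_of_setD(1)[OF xs] by simp
      then show "(xs!0, xs!1, xs!2, xs!3) \<in> ?T"
        using e H[OF e] by (auto simp: numeral_3_eq_3)
    qed
  qed auto
  then have "card ?T = card (\<Union>e\<in>H. permutations_of_set e)" by (rule bij_betw_same_card)
  also have "\<dots> = (\<Sum>e\<in>H. card (permutations_of_set e))"
    by (rule card_UN_disjoint) (use finH H in \<open>auto dest!: permutations_of_setD(1)\<close>)
  also have "\<dots> = (\<Sum>e\<in>H. 24)"
    using H by (intro sum.cong) (auto simp: fact_numeral)
  finally show ?thesis by simp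
qed

text \<open>The sum of \<open>h a b c d * h a b e f\<close> is the sum of the squares of the degrees of the pairs
\<open>(a, b)\<close>, so the Cauchy--Schwarz inequality applies.\<close>

lemma sum_pair_degree_squares_ge:
  fixes h :: "'a \<Rightarrow> 'a \<Rightarrow> 'a \<Rightarrow> 'a \<Rightarrow> real"
  assumes "finite V"
  shows "(\<Sum>a\<in>V. \<Sum>b\<in>V. \<Sum>c\<in>V. \<Sum>d\<in>V. h a b c d)\<^sup>2
     \<le> real (card V) ^ 2 * (\<Sum>(a,b,c,d,e,f)\<in>tuples6 V. h a b c d * h a b e f)"
proof -
  define D where "D a b = (\<Sum>c\<in>V. \<Sum>d\<in>V. h a b c d)" for a b
  have "(\<Sum>(a,b)\<in>V\<times>V. D a b)\<^sup>2 \<le> (\<Sum>(a,b)\<in>V\<times>V. (D a b)\<^sup>2) * real (card (V \<times> V))"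
    using sum_squared_le_sum_of_squares[of "\<lambda>(a,b). D a b" "V \<times> V"]
    by (simp only: case_prod_unfold)
  then have "(\<Sum>a\<in>V. \<Sum>b\<in>V. D a b)\<^sup>2 \<le> (\<Sum>a\<in>V. \<Sum>b\<in>V. (D a b)\<^sup>2) * real (card (V \<times> V))"
    by (simp only: sum.cartesian_product)
  also have "(\<Sum>a\<in>V. \<Sum>b\<in>V. (D a b)\<^sup>2) =
      (\<Sum>a\<in>V. \<Sum>b\<in>V. \<Sum>c\<in>V. \<Sum>d\<in>V. \<Sum>e\<in>V. \<Sum>f\<in>V. h a b c d * h a b e f)"
    by (simp only: D_def power2_eq_square sum_distrib_right) (simp only: sum_distrib_left)
  also have "\<dots> = (\<Sum>(a,b,c,d,e,f)\<in>tuples6 V. h a b c d * h a b e f)"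
    by (simp only: tuples6_def sum.cartesian_product[symmetric])
  finally show ?thesis
    by (simp only: D_def card_cartesian_product of_nat_mult power2_eq_square mult.commute)
qed

lemma choose_four_bounds:
  assumes "n \<ge> 1"
  shows "real n ^ 4 - 6 * real n ^ 3 \<le> 24 * real (n choose 4)" "24 * real (n choose 4) \<le> real n ^ 4"
proof -
  let ?x = "real n"
  have eq: "24 * real (n choose 4) = ?x * (?x - 1) * (?x - 2) * (?x - 3)"
    by (simp add: binomial_gbinomial gbinomial_prod_rev numeral_eq_Suc atLeast0_lessThan_Suc
        fact_numeral field_simps)
  have x: "?x \<ge> 1" using assms by simp
  have "0 \<le> ?x * (11 * (?x - 1) + 5)" "0 \<le> ?x * ((6 * ?x - 5) * (?x - 1) + 1)"
    using x by (intro mult_nonneg_nonneg add_nonneg_nonneg; simp)+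
  then show "?x ^ 4 - 6 * ?x ^ 3 \<le> 24 * real (n choose 4)" "24 * real (n choose 4) \<le> ?x ^ 4"
    unfolding eq by (simp_all add: algebra_simps eval_nat_numeral)
qed

text \<open>Let \<open>\<mu>\<close> be the density of ordered edges.  By Cauchy--Schwarz two edges sharing a pair have density at
least \<open>\<mu>\<^sup>2\<close>, so up to degenerate tuples the density of odd matchings is at most a constant times
\<open>\<mu> - 2 \<mu>\<^sup>2 = \<mu> (1 - 2 \<mu>)\<close>, which is at most about \<open>2 \<epsilon>\<close> because \<open>\<mu>\<close> is not much smaller than one half.\<close>

lemma card_odd_tuples_le:
  fixes \<epsilon> :: real
  assumes graph: "four_graph V H" and free: "hfree V H C64_vertices C64_minus"
    and dense: "real (card H) \<ge> (1/2 - \<epsilon>) * real (card V choose 4)"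
    and n: "card V \<ge> 1" and \<epsilon>: "\<epsilon> \<ge> 0"
  shows "real (card {(a,b,c,d,e,f)\<in>tuples6 V. \<not> even_matching H a b c d e f})
     \<le> 30 * \<epsilon> * real (card V) ^ 6 + 555 * real (card V) ^ 5"
proof -
  let ?x = "real (card V)" and ?I = "distinct6 V" and ?A = "tuples6 V"
  define h :: "'a \<Rightarrow> 'a \<Rightarrow> 'a \<Rightarrow> 'a \<Rightarrow> real" where "h a b c d = of_bool ({a,b,c,d} \<in> H)" for a b c d
  define X where "X = (\<lambda>(a,b,c,d,e::'a,f::'a). h a b c d)"
  define XY where "XY = (\<lambda>(a,b,c,d,e,f). h a b c d * h a b e f)"
  define M where "M = (\<Sum>a\<in>V. \<Sum>b\<in>V. \<Sum>c\<in>V. \<Sum>d\<in>V. h a b c d)"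
  define \<mu> where "\<mu> = M / ?x ^ 4"
  have fin: "finite V" using graph by (simp add: four_graph_def)
  have x: "?x \<ge> 1" using n by simp
  have finA: "finite ?A" using fin by (simp add: tuples6_def)
  have IA: "?I \<subseteq> ?A" by (auto simp: distinct6_def tuples6_def)
  have cardA: "real (card ?A) = ?x ^ 6"
    by (simp add: tuples6_def card_cartesian_product eval_nat_numeral)
  have card_diff: "real (card (?A - ?I)) \<le> 15 * ?x ^ 5"
    using card_Diff_subset[OF finite_subset[OF IA finA] IA] card_mono[OF finA IA]
      card_distinct6_ge[OF fin] cardA by (simp add: of_nat_diff)
  have M_card: "M = 24 * real (card H)"
  proof -
    have set_eq: "{(a,b,c,d)\<in>V \<times> V \<times> V \<times> V. {a,b,c,d} \<in> H}
        = (V \<times> V \<times> V \<times> V) \<inter> {(a,b,c,d). {a,b,c,d} \<in> H}" by auto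
    have "M = (\<Sum>(a,b,c,d)\<in>V \<times> V \<times> V \<times> V. h a b c d)"
      by (simp only: M_def sum.cartesian_product[symmetric])
    also have "\<dots> = (\<Sum>p\<in>V \<times> V \<times> V \<times> V. of_bool (case p of (a,b,c,d) \<Rightarrow> {a,b,c,d} \<in> H))"
      by (intro sum.cong) (auto simp: h_def)
    also have "\<dots> = real (card {(a,b,c,d)\<in>V \<times> V \<times> V \<times> V. {a,b,c,d} \<in> H})"
      unfolding set_eq using fin by (subst sum_of_bool_eq) (auto simp: case_prod_unfold)
    finally show ?thesis using card_edge_tuples[OF graph] by simp
  qed
  have "M \<le> (\<Sum>a\<in>V. \<Sum>b\<in>V. \<Sum>c\<in>V. \<Sum>d\<in>V. 1)"
    unfolding M_def by (intro sum_mono) (simp add: h_def)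
  then have M_le: "M \<le> ?x ^ 4" by (simp add: eval_nat_numeral)
  have M_ge: "M \<ge> ?x ^ 4 / 2 - 3 * ?x ^ 3 - \<epsilon> * ?x ^ 4"
  proof -
    have "M \<ge> 24 * real (card V choose 4) / 2 - \<epsilon> * (24 * real (card V choose 4))"
      using dense unfolding M_card by (simp add: algebra_simps)
    moreover have "\<epsilon> * (24 * real (card V choose 4)) \<le> \<epsilon> * ?x ^ 4"
      using choose_four_bounds(2)[OF n] \<epsilon> by (rule mult_left_mono)
    ultimately show ?thesis using choose_four_bounds(1)[OF n] by linarith
  qed
  have \<mu>: "0 \<le> \<mu>" "\<mu> \<le> 1" "1 - 2 * \<mu> \<le> 6 / ?x + 2 * \<epsilon>"
  proof -
    show "0 \<le> \<mu>" by (simp add: \<mu>_def M_card)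
    show "\<mu> \<le> 1" using M_le x by (simp add: \<mu>_def divide_le_eq)
    have "(?x ^ 4 / 2 - 3 * ?x ^ 3 - \<epsilon> * ?x ^ 4) / ?x ^ 4 \<le> \<mu>"
      unfolding \<mu>_def using M_ge x by (intro divide_right_mono) auto
    moreover have "(?x ^ 4 / 2 - 3 * ?x ^ 3 - \<epsilon> * ?x ^ 4) / ?x ^ 4 = 1/2 - 3 / ?x - \<epsilon>"
      using x by (simp add: field_simps eval_nat_numeral)
    ultimately show "1 - 2 * \<mu> \<le> 6 / ?x + 2 * \<epsilon>" by simp
  qed
  have M_\<mu>: "M = \<mu> * ?x ^ 4" using x by (simp add: \<mu>_def)
  have sumX: "sum X ?A = \<mu> * ?x ^ 6"
  proof -
    have "sum X ?A = (\<Sum>a\<in>V. \<Sum>b\<in>V. \<Sum>c\<in>V. \<Sum>d\<in>V. \<Sum>e\<in>V. \<Sum>f\<in>V. h a b c d)"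
      by (simp only: X_def tuples6_def sum.cartesian_product[symmetric])
    also have "\<dots> = ?x * ?x * M" by (simp add: M_def sum_distrib_left algebra_simps)
    finally show ?thesis by (simp add: M_\<mu> eval_nat_numeral)
  qed
  have sumXY: "sum XY ?A \<ge> \<mu>\<^sup>2 * ?x ^ 6"
  proof -
    have "M\<^sup>2 \<le> ?x ^ 2 * sum XY ?A"
      unfolding M_def XY_def by (rule sum_pair_degree_squares_ge[OF fin])
    then have "?x ^ 2 * (\<mu>\<^sup>2 * ?x ^ 6) \<le> ?x ^ 2 * sum XY ?A"
      by (simp add: M_\<mu> power_mult_distrib flip: power_mult power_add mult.assoc)
         (simp add: algebra_simps flip: power_add)
    then show ?thesis using x by simp
  qed
  have sumX_I: "sum X ?I \<le> sum X ?A"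
    using IA finA by (intro sum_mono2) (auto simp: X_def h_def)
  have sumXY_I: "sum XY ?A - 15 * ?x ^ 5 \<le> sum XY ?I"
  proof -
    have "sum XY ?A = sum XY ?I + sum XY (?A - ?I)"
      using sum.subset_diff[OF IA finA, of XY] by simp
    moreover have "sum XY (?A - ?I) \<le> (\<Sum>p\<in>?A - ?I. 1)"
      by (intro sum_mono) (auto simp: XY_def h_def)
    ultimately show ?thesis using card_diff by simp
  qed
  have "real (card {(a,b,c,d,e,f)\<in>?I. \<not> even_matching H a b c d e f})
     \<le> 15 * (sum X ?I - 2 * sum XY ?I)"
  proof -
    have "sum X ?I - 2 * sum XY ?I = real_of_int (\<Sum>(a,b,c,d,e,f)\<in>?I.
       of_bool ({a,b,c,d} \<in> H) - 2 * (of_bool ({a,b,c,d} \<in> H) * of_bool ({a,b,e,f} \<in> H)))"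
      by (simp add: X_def XY_def h_def case_prod_unfold sum_subtractf sum_distrib_left)
    moreover have "real_of_int (int (card {(a,b,c,d,e,f)\<in>?I. \<not> even_matching H a b c d e f}))
       \<le> real_of_int (15 * (\<Sum>(a,b,c,d,e,f)\<in>?I.
       of_bool ({a,b,c,d} \<in> H) - 2 * (of_bool ({a,b,c,d} \<in> H) * of_bool ({a,b,e,f} \<in> H))))"
      unfolding of_int_le_iff by (rule card_odd_matchings_le[OF fin free])
    ultimately show ?thesis by (simp only: of_int_of_nat_eq of_int_mult of_int_numeral)
  qed
  also have "\<dots> \<le> 15 * (\<mu> * (1 - 2 * \<mu>) * ?x ^ 6 + 30 * ?x ^ 5)"
    using sumX sumXY sumX_I sumXY_I by (simp add: algebra_simps power2_eq_square)
  also have "\<dots> \<le> 15 * ((6 / ?x + 2 * \<epsilon>) * ?x ^ 6 + 30 * ?x ^ 5)"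
  proof -
    have "\<mu> * (1 - 2 * \<mu>) \<le> \<mu> * (6 / ?x + 2 * \<epsilon>)"
      using \<mu> by (intro mult_left_mono)
    also have "\<dots> \<le> 1 * (6 / ?x + 2 * \<epsilon>)"
      using \<mu> \<epsilon> x by (intro mult_right_mono) auto
    finally show ?thesis by (simp add: mult_right_mono)
  qed
  also have "\<dots> = 30 * \<epsilon> * ?x ^ 6 + 540 * ?x ^ 5"
    using x by (simp add: field_simps eval_nat_numeral)
  finally have odd_I: "real (card {(a,b,c,d,e,f)\<in>?I. \<not> even_matching H a b c d e f})
     \<le> 30 * \<epsilon> * ?x ^ 6 + 540 * ?x ^ 5" .
  have "{(a,b,c,d,e,f)\<in>?A. \<not> even_matching H a b c d e f}
     \<subseteq> {(a,b,c,d,e,f)\<in>?I. \<not> even_matching H a b c d e f} \<union> (?A - ?I)" by auto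
  then have "card {(a,b,c,d,e,f)\<in>?A. \<not> even_matching H a b c d e f}
     \<le> card ({(a,b,c,d,e,f)\<in>?I. \<not> even_matching H a b c d e f} \<union> (?A - ?I))"
    by (rule card_mono[rotated]) (use finA IA in \<open>auto intro: finite_subset\<close>)
  also have "\<dots> \<le> card {(a,b,c,d,e,f)\<in>?I. \<not> even_matching H a b c d e f} + card (?A - ?I)"
    by (rule card_Un_le)
  finally show ?thesis using odd_I card_diff by linarith
qed


section \<open>From even matchings to an odd-bipartite structure\<close>

lemma exists_small_section:
  assumes "finite W" "W \<noteq> {}" "finite Z"
    and "real (card {(w,z)\<in>W \<times> Z. P w z}) \<le> B * real (card W)"
  shows "\<exists>w\<in>W. real (card {z\<in>Z. P w z}) \<le> B"
proof (rule ccontr)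
  assume "\<not> ?thesis"
  then have "(\<Sum>w\<in>W. B) < (\<Sum>w\<in>W. real (card {z\<in>Z. P w z}))"
    using assms by (intro sum_strict_mono) auto
  also have "\<dots> = real (card (SIGMA w:W. {z\<in>Z. P w z}))"
    using assms by simp
  also have "(SIGMA w:W. {z\<in>Z. P w z}) = {(w,z)\<in>W \<times> Z. P w z}" by auto
  finally show False using assms(4) by (simp add: mult.commute)
qed

text \<open>Write \<open>H\<close> also for its indicator modulo two.  The first hypothesis says
\<open>H(abcd) = H(abxy) + H(cdxy)\<close>.  Adding \<open>H(bcxy)\<close> twice, it remains to see that
\<open>H(bxya) + H(bxyc) = H(rsya) + H(rsyc)\<close> and likewise with \<open>b, d\<close> in place of \<open>a, c\<close> and \<open>c\<close> in place of
\<open>b\<close>.  The first of these holds because the matchings \<open>bx, ya, rs\<close> and \<open>bx, yc, rs\<close> are even and the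
common term \<open>H(bxrs)\<close> cancels.  Thus \<open>H(abcd)\<close> depends only on which of \<open>a, b, c, d\<close> complete the
fixed triple \<open>r, s, y\<close> to an edge.\<close>

lemma even_matchings_imp_parity:
  assumes "even_matching H a b c d x y"
    and "even_matching H b x y a r s" "even_matching H b x y c r s"
    and "even_matching H c x y b r s" "even_matching H c x y d r s"
  shows "{a,b,c,d} \<in> H \<longleftrightarrow>
     (({r,s,y,a} \<in> H) \<noteq> ({r,s,y,b} \<in> H)) \<noteq> (({r,s,y,c} \<in> H) \<noteq> ({r,s,y,d} \<in> H))"
proof -
  have perms: "{b,x,y,a} = {a,b,x,y}" "{b,x,y,c} = {c,x,y,b}" "{c,x,y,d} = {c,d,x,y}"
    "{y,a,r,s} = {r,s,y,a}" "{y,b,r,s} = {r,s,y,b}" "{y,c,r,s} = {r,s,y,c}" "{y,d,r,s} = {r,s,y,d}"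
    by auto
  show ?thesis using assms unfolding even_matching_def perms by argo
qed

lemma odd_card_Int_iff:
  assumes "distinct [a,b,c,d]"
  shows "odd (card ({a,b,c,d} \<inter> A)) \<longleftrightarrow> ((a \<in> A) \<noteq> (b \<in> A)) \<noteq> ((c \<in> A) \<noteq> (d \<in> A))"
  using assms by (cases "a \<in> A"; cases "b \<in> A"; cases "c \<in> A"; cases "d \<in> A"; simp)

text \<open>The five matchings behind the parity formula are all even for all but a fraction \<open>5 \<eta>\<close> of the
eight-tuples \<open>(x, y, r, s, a, b, c, d)\<close>.  Some choice of \<open>x, y, r, s\<close> is at least as good as the
average; for this choice the link of \<open>{r, s, y}\<close> serves as the first part, and every edge that has to
be changed comes from an exceptional quadruple \<open>(a, b, c, d)\<close>.\<close>

lemma exists_odd_bipartite_close: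
  assumes graph: "four_graph V H" and "V \<noteq> {}"
    and bad: "real (card {(a,b,c,d,e,f)\<in>tuples6 V. \<not> even_matching H a b c d e f})
                \<le> \<eta> * real (card V) ^ 6"
  shows "\<exists>B. complete_odd_bipartite V B \<and>
           real (card (H - B) + card (B - H)) \<le> 5 * \<eta> * real (card V) ^ 4"
proof -
  let ?x = "real (card V)" and ?Q = "V \<times> V \<times> V \<times> V"
  define Odd where "Odd = {(a,b,c,d,e,f)\<in>tuples6 V. \<not> even_matching H a b c d e f}"
  have fin: "finite V" using graph by (simp add: four_graph_def)
  have finO: "finite Odd"
    by (rule finite_subset[of _ "tuples6 V"]) (auto simp: Odd_def tuples6_def fin)
  define R where "R = (\<lambda>i::nat. \<lambda>((x::'a,y::'a,r::'a,s::'a),(a::'a,b::'a,c::'a,d::'a)).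
     [(a,b,c,d,x,y), (b,x,y,a,r,s), (b,x,y,c,r,s), (c,x,y,b,r,s), (c,x,y,d,r,s)] ! i)"
  let ?L = "\<lambda>i. {p\<in>?Q \<times> ?Q. R i p \<in> Odd}"
  \<comment> \<open>The two coordinates missing from the \<open>i\<close>-th matching, so that \<open>R i\<close> and \<open>rest i\<close> together are
    injective.\<close>
  define rest where "rest = (\<lambda>i::nat. \<lambda>((x::'a,y::'a,r::'a,s::'a),(a::'a,b::'a,c::'a,d::'a)).
     [(r,s), (c,d), (a,d), (a,d), (a,b)] ! i)"
  have cardL: "card (?L i) \<le> card (Odd \<times> V \<times> V)" if i: "i < 5" for i
  proof (rule card_inj_on_le[of "\<lambda>p. (R i p, rest i p)"])
    have i5: "i = 0 \<or> i = 1 \<or> i = 2 \<or> i = 3 \<or> i = 4" using i by linarith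
    show "inj_on (\<lambda>p. (R i p, rest i p)) (?L i)"
      using i5 by (elim disjE) (auto simp: inj_on_def R_def rest_def)
    show "(\<lambda>p. (R i p, rest i p)) ` ?L i \<subseteq> Odd \<times> V \<times> V"
    proof (rule image_subsetI)
      fix p assume p: "p \<in> ?L i"
      then have "rest i p \<in> V \<times> V" using i5 by (elim disjE) (auto simp: rest_def)
      then show "(R i p, rest i p) \<in> Odd \<times> V \<times> V" using p by blast
    qed
    show "finite (Odd \<times> V \<times> V)" using finO fin by simp
  qed
  let ?P = "\<lambda>w z. \<exists>i<5. R i (w, z) \<in> Odd"
  have "{(w,z)\<in>?Q \<times> ?Q. ?P w z} \<subseteq> (\<Union>i<5. ?L i)" by auto
  then have "card {(w,z)\<in>?Q \<times> ?Q. ?P w z} \<le> card (\<Union>i<5. ?L i)"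
    by (rule card_mono[rotated]) (auto simp: fin)
  also have "\<dots> \<le> (\<Sum>i<5. card (?L i))" by (rule card_UN_le) simp
  also have "\<dots> \<le> (\<Sum>i<(5::nat). card (Odd \<times> V \<times> V))" using cardL by (intro sum_mono) auto
  also have "\<dots> = 5 * (card Odd * card V ^ 2)"
    by (simp add: card_cartesian_product power2_eq_square)
  finally have "real (card {(w,z)\<in>?Q \<times> ?Q. ?P w z}) \<le> real (5 * (card Odd * card V ^ 2))"
    by (rule of_nat_mono)
  also have "\<dots> = 5 * ?x ^ 2 * real (card Odd)" by simp
  also have "\<dots> \<le> 5 * ?x ^ 2 * (\<eta> * ?x ^ 6)" using bad unfolding Odd_def[symmetric] by (intro mult_left_mono) auto
  also have "\<dots> = 5 * \<eta> * ?x ^ 4 * real (card ?Q)"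
    by (simp add: card_cartesian_product eval_nat_numeral)
  finally obtain w where w: "w \<in> ?Q" and small: "real (card {z\<in>?Q. ?P w z}) \<le> 5 * \<eta> * ?x ^ 4"
    using exists_small_section[of ?Q ?Q ?P "5 * \<eta> * ?x ^ 4"] fin \<open>V \<noteq> {}\<close> by auto
  obtain x y r s where w_eq: "w = (x,y,r,s)" by (cases w)
  define V1 where "V1 = {v\<in>V. {r,s,y,v} \<in> H}"
  define B where "B = {e \<in> nsets V 4. odd (card (e \<inter> V1))}"
  have B: "complete_odd_bipartite V B"
    unfolding complete_odd_bipartite_def B_def
    by (rule exI[of _ V1], rule exI[of _ "V - V1"]) (auto simp: V1_def)
  have "(H - B) \<union> (B - H) \<subseteq> (\<lambda>(a,b,c,d). {a,b,c,d}) ` {z\<in>?Q. ?P w z}"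
  proof
    fix e assume e: "e \<in> (H - B) \<union> (B - H)"
    then have e4: "e \<in> nsets V 4" using graph by (auto simp: B_def four_graph_def)
    then obtain a b c d where abcd: "e = {a,b,c,d}" "distinct [a,b,c,d]"
      by (auto simp: nsets_def card_Suc_eq numeral_eq_Suc)
    have V: "a \<in> V" "b \<in> V" "c \<in> V" "d \<in> V" using e4 abcd by (auto simp: nsets_def)
    have "?P w (a,b,c,d)"
    proof (rule ccontr)
      assume "\<not> ?P w (a,b,c,d)"
      then have ok: "R i (w, (a,b,c,d)) \<notin> Odd" if "i < 5" for i using that by blast
      have "even_matching H a b c d x y" "even_matching H b x y a r s" "even_matching H b x y c r s"
        "even_matching H c x y b r s" "even_matching H c x y d r s"
        using ok[of 0] ok[of 1] ok[of 2] ok[of 3] ok[of 4] V w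
        by (auto simp: Odd_def R_def w_eq tuples6_def)
      then have "{a,b,c,d} \<in> H \<longleftrightarrow> odd (card ({a,b,c,d} \<inter> V1))"
        unfolding odd_card_Int_iff[OF abcd(2)] using V
        by (subst even_matchings_imp_parity) (auto simp: V1_def)
      then show False using e e4 abcd(1) by (auto simp: B_def)
    qed
    then show "e \<in> (\<lambda>(a,b,c,d). {a,b,c,d}) ` {z\<in>?Q. ?P w z}"
      using V abcd(1) by (intro image_eqI[of _ _ "(a,b,c,d)"]) auto
  qed
  then have "card ((H - B) \<union> (B - H)) \<le> card {z\<in>?Q. ?P w z}"
    by (rule surj_card_le[rotated]) (auto simp: fin)
  moreover have "card ((H - B) \<union> (B - H)) = card (H - B) + card (B - H)"
  proof (rule card_Un_disjoint)
    have "H \<subseteq> Pow V" "B \<subseteq> Pow V" using graph by (auto simp: four_graph_def B_def nsets_def)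
    then show "finite (H - B)" "finite (B - H)" using fin by (meson finite_Diff finite_Pow_iff finite_subset)+
  qed auto
  ultimately have "real (card (H - B) + card (B - H)) \<le> 5 * \<eta> * ?x ^ 4"
    using small by linarith
  then show ?thesis using B by blast
qed

section \<open>Stability\<close>

text \<open>
The choice \<open>\<epsilon> = \<delta> / 300\<close> gives half of the permitted odd matchings to \<open>30 \<epsilon> n\<^sup>6 = \<delta> n\<^sup>6 / 10\<close>; the other
half absorbs the lower-order term \<open>555 n\<^sup>5\<close> once \<open>n \<ge> 5550 / \<delta>\<close>.  The factor five lost in passing from
matchings to edges turns the total \<open>\<delta> / 5\<close> into \<open>\<delta>\<close>.\<close>

theorem theorem1p3:
  fixes \<delta> :: real
  assumes "\<delta> > 0"
  shows "\<exists>(\<epsilon>::real) > 0. \<exists>N0::nat. \<forall>(V :: 'a set) (H :: 'a set set).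
           four_graph V H \<and> card V \<ge> N0 \<and>
           hfree V H C64_vertices C64_minus \<and>
           real (card H) \<ge> (1/2 - \<epsilon>) * real (card V choose 4)
           \<longrightarrow> (\<exists>B. complete_odd_bipartite V B \<and>
                  real (card (H - B) + card (B - H)) \<le> \<delta> * real (card V) ^ 4)"
proof (intro exI[of _ "\<delta> / 300"] conjI exI[of _ "nat \<lceil>5550 / \<delta>\<rceil> + 1"] allI impI)
  show "\<delta> / 300 > 0" using assms by simp
  fix V :: "'a set" and H :: "'a set set"
  let ?x = "real (card V)"
  assume *: "four_graph V H \<and> card V \<ge> nat \<lceil>5550 / \<delta>\<rceil> + 1 \<and>
    hfree V H C64_vertices C64_minus \<and> real (card H) \<ge> (1/2 - \<delta> / 300) * real (card V choose 4)"
  then have n: "card V \<ge> 1" by simp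
  have "5550 / \<delta> \<le> ?x" using * by linarith
  then have "555 \<le> \<delta> / 10 * ?x" using assms by (simp add: field_simps)
  then have "555 * ?x ^ 5 \<le> \<delta> / 10 * ?x * ?x ^ 5" by (intro mult_right_mono) auto
  moreover have "real (card {(a,b,c,d,e,f)\<in>tuples6 V. \<not> even_matching H a b c d e f})
     \<le> 30 * (\<delta> / 300) * ?x ^ 6 + 555 * ?x ^ 5"
    using * n assms by (intro card_odd_tuples_le) auto
  ultimately have "real (card {(a,b,c,d,e,f)\<in>tuples6 V. \<not> even_matching H a b c d e f})
     \<le> \<delta> / 5 * ?x ^ 6"
    by (simp add: eval_nat_numeral)
  moreover have "V \<noteq> {}" using n by auto
  ultimately show "\<exists>B. complete_odd_bipartite V B \<and>
      real (card (H - B) + card (B - H)) \<le> \<delta> * real (card V) ^ 4"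
    using exists_odd_bipartite_close[of V H "\<delta> / 5"] * by simp
qed

end
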